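(* For $n\ge1$, define $$g_n:=2^{3+\nu_2(n)}\prod_{\substack{p\ \text{odd prime}\\ p-1\mid 2n}}p .$$ Then $$\operatorname{cont}(W_n-1)=g_n .$$ In particular, $W_n(q)\equiv1\pmod{g_n}$ coefficientwise, and the modulus is best possible. Moreover, $$g_n=2^{2+\nu_2(n)}\operatorname{den}(B_{2n}).$$
   Context: Put $T_k=k(k+1)/2$. For $n\ge0$, let $N_n(q):=\sum_{k\ge0}(-1)^{T_k}(2k+1)^{2n+1}q^{T_k}$, $D:=N_0$, and $W_n:=N_n/D$, regarded as formal power series; since $D(0)=1$, $W_n\in\mathbb Z[[q]]$. For a nonzero series $F\in\mathbb Z[[q]]$, $\operatorname{cont}(F)$ denotes the positive generator of the ideal of $\mathbb Z$ generated by its coefficients. $\nu_p$ is the normalized $p$-adic valuation, and $\operatorname{den}(x)$ is the positive denominator of a rational number $x$ in lowest terms. The Bernoulli numbers are normalized by $x/(e^x-1)=\sum_{j\ge0}B_jx^j/j!$. *)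

theory Defs
  imports
    "HOL-Computational_Algebra.Computational_Algebra"
    "HOL-Number_Theory.Cong"
    "HOL-Algebra.IntRing"
begin

definition tri :: "nat \<Rightarrow> nat" where
  "tri k = k * (k + 1) div 2"

definition tri_term :: "nat \<Rightarrow> nat \<Rightarrow> int fps" where
  "tri_term n k = fps_const ((- 1) ^ tri k * (2 * int k + 1) ^ (2 * n + 1)) * fps_X ^ tri k"

text \<open>The infinite sum is taken in the topology of formal power series.\<close>

definition N_ser :: "nat \<Rightarrow> int fps" where
  "N_ser n = (\<Sum>k. tri_term n k)"

abbreviation D_ser :: "int fps" where
  "D_ser \<equiv> N_ser 0"

text \<open>
  The type \<^typ>\<open>int fps\<close> has no division operation in the library. As \<^term>\<open>D_ser\<close> has
  constant coefficient \<open>1\<close>, the quotient is the product with its inverse in the ring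
  of integral power series; the second argument of \<open>fps_right_inverse\<close> is the constant
  coefficient of that inverse. See lemma \<open>D_mult_W\<close> below.
\<close>

definition W_ser :: "nat \<Rightarrow> int fps" where
  "W_ser n = N_ser n * fps_right_inverse D_ser 1"

text \<open>Meaningful only for nonzero \<open>F\<close>: the zero ideal has no positive generator.\<close>

definition cont :: "int fps \<Rightarrow> int" where
  "cont F = (THE c. c > 0 \<and> Idl\<^bsub>\<Z>\<^esub> (range (fps_nth F)) = Idl\<^bsub>\<Z>\<^esub> {c})"

definition g_mod :: "nat \<Rightarrow> nat" where
  "g_mod n = 2 ^ (3 + multiplicity 2 n) * \<Prod>{p. prime p \<and> odd p \<and> (p - 1) dvd 2 * n}"

definition bernoulli :: "nat \<Rightarrow> rat" where
  "bernoulli j = fact j * fps_nth (fps_X / (fps_exp 1 - 1)) j"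

definition den :: "rat \<Rightarrow> int" where
  "den x = snd (quotient_of x)"


lemma strict_mono_tri: "strict_mono tri"
  unfolding strict_mono_Suc_iff
proof
  fix k
  have "Suc k * (Suc k + 1) = k * (k + 1) + 2 * Suc k"
    by (simp add: algebra_simps)
  thus "tri k < tri (Suc k)"
    unfolding tri_def by simp
qed

lemma tri_term_nth:
  "fps_nth (tri_term n k) m =
     (if m = tri k then (- 1) ^ tri k * (2 * int k + 1) ^ (2 * n + 1) else 0)"
  by (simp add: tri_term_def fps_X_power_nth)

lemma tri_term_sums:
  "tri_term n sums
     Abs_fps (\<lambda>m. \<Sum>k | tri k = m. (- 1) ^ tri k * (2 * int k + 1) ^ (2 * n + 1))"
  unfolding sums_def
proof (rule tendsto_fpsI)
  fix m
  let ?c = "\<lambda>k. (- 1) ^ tri k * (2 * int k + 1) ^ (2 * n + 1)"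
  have "fps_nth (\<Sum>k<l. tri_term n k) m = (\<Sum>k | tri k = m. ?c k)" if l: "l > m" for l
  proof -
    have sub: "{k. tri k = m} \<subseteq> {..<l}"
      using strict_mono_imp_increasing[OF strict_mono_tri] l by (auto intro: le_less_trans)
    have "fps_nth (\<Sum>k<l. tri_term n k) m = (\<Sum>k<l. if m = tri k then ?c k else 0)"
      by (simp add: fps_sum_nth tri_term_nth)
    also have "\<dots> = (\<Sum>k | tri k = m. ?c k)"
      using sub by (intro sum.mono_neutral_cong_right) auto
    finally show ?thesis .
  qed
  thus "\<forall>\<^sub>F l in sequentially. fps_nth (\<Sum>k<l. tri_term n k) m =
          fps_nth (Abs_fps (\<lambda>m. \<Sum>k | tri k = m. ?c k)) m"
    unfolding eventually_sequentially by (intro exI[of _ "Suc m"]) auto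
qed

lemma N_ser_nth:
  "fps_nth (N_ser n) m = (\<Sum>k | tri k = m. (- 1) ^ tri k * (2 * int k + 1) ^ (2 * n + 1))"
  unfolding N_ser_def sums_unique[OF tri_term_sums, symmetric] by simp

lemma N_ser_nth_0: "fps_nth (N_ser n) 0 = 1"
proof -
  have "tri k = 0 \<longleftrightarrow> k = 0" for k
    using strict_mono_eq[OF strict_mono_tri, of k 0] by (simp add: tri_def)
  hence "{k. tri k = 0} = {0}" by auto
  thus ?thesis by (simp add: N_ser_nth tri_def)
qed

lemma D_mult_W: "D_ser * W_ser n = N_ser n"
proof -
  have "D_ser * fps_right_inverse D_ser 1 = 1"
    by (rule fps_right_inverse) (simp add: N_ser_nth_0)
  thus ?thesis
    by (simp add: W_ser_def mult.left_commute)
qed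

lemma Idl_eq_Idl_Gcd: "Idl\<^bsub>\<Z>\<^esub> (A :: int set) = Idl\<^bsub>\<Z>\<^esub> {Gcd A}"
proof
  let ?I = "Idl\<^bsub>\<Z>\<^esub> A"
  have A: "A \<subseteq> ?I"
    by (rule int.genideal_self) simp
  interpret I: ideal ?I \<Z>
    by (rule int.genideal_ideal) simp
  have add: "x + y \<in> ?I" if "x \<in> ?I" "y \<in> ?I" for x y
    using I.a_closed that by simp
  have mul: "x * y \<in> ?I" if "y \<in> ?I" for x y
    using I.I_l_closed[of y x] that by simp
  show "?I \<subseteq> Idl\<^bsub>\<Z>\<^esub> {Gcd A}"
    by (rule int.genideal_minimal[OF int.genideal_ideal])
       (auto simp: int_Idl dvd_def mult.commute dest!: Gcd_dvd)
  define M where "M = {k :: nat. int k \<in> ?I}"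
  have "Gcd M \<in> M"
  proof (rule Gcd_in)
    fix a b assume "a \<in> M" "b \<in> M"
    moreover obtain u v where "u * int a + v * int b = gcd (int a) (int b)"
      using bezout_int by blast
    ultimately show "gcd a b \<in> M"
      using add[OF mul[of "int a" u] mul[of "int b" v]] by (simp add: M_def)
  next
    have "0 \<in> M" using I.zero_closed by (simp add: M_def)
    thus "M \<noteq> {}" by blast
  qed
  have "int (Gcd M) dvd a" if a: "a \<in> A" for a
  proof -
    have "\<bar>a\<bar> = sgn a * a" by (simp add: abs_if sgn_if)
    hence "nat \<bar>a\<bar> \<in> M" using mul[of a "sgn a"] a A by (auto simp: M_def)
    hence "Gcd M dvd nat \<bar>a\<bar>" by (rule Gcd_dvd)
    thus ?thesis by simp
  qed
  hence "int (Gcd M) dvd Gcd A" by (rule Gcd_greatest)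
  then obtain c where "Gcd A = c * int (Gcd M)" by (auto simp: dvd_def mult.commute)
  hence "Gcd A \<in> ?I" using mul \<open>Gcd M \<in> M\<close> by (simp add: M_def del: Gcd_int_eq)
  thus "Idl\<^bsub>\<Z>\<^esub> {Gcd A} \<subseteq> ?I"
    by (intro int.genideal_minimal I.ideal_axioms) auto
qed

lemma cont_eq_Gcd:
  assumes "F \<noteq> 0"
  shows "cont F = Gcd (range (fps_nth F))"
proof -
  have "Gcd (range (fps_nth F)) \<noteq> 0"
    using assms by (auto simp: fps_eq_iff)
  hence "Gcd (range (fps_nth F)) > 0"
    using Gcd_int_greater_eq_0[of "range (fps_nth F)"] by linarith
  thus ?thesis
    unfolding cont_def Idl_eq_Idl_Gcd[of "range (fps_nth F)"]
    by (intro the_equality) (auto simp: Idl_eq_abs)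
qed

lemma finite_g_mod_primes:
  assumes "n \<ge> 1"
  shows "finite {p :: nat. prime p \<and> odd p \<and> (p - 1) dvd 2 * n}"
proof (rule finite_subset)
  show "{p :: nat. prime p \<and> odd p \<and> (p - 1) dvd 2 * n} \<subseteq> {..2 * n + 1}"
    using assms by (auto dest!: dvd_imp_le)
qed simp

lemma bernoulli_fps:
  "fps_X / (fps_exp 1 - 1) = Abs_fps (\<lambda>j. bernoulli j / fact j)"
  by (simp add: fps_eq_iff bernoulli_def)

lemma bernoulli_fps_mult:
  "(fps_exp 1 - 1) * Abs_fps (\<lambda>j. bernoulli j / fact j) = fps_X"
proof -
  have 1: "subdegree (fps_exp 1 - 1 :: rat fps) = 1"
    by (rule subdegreeI) auto
  hence "fps_exp 1 - 1 \<noteq> (0 :: rat fps)" by auto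
  thus ?thesis
    unfolding bernoulli_fps [symmetric] using 1
    by (intro dvd_mult_div_cancel) (simp add: fps_dvd_iff)
qed

end

theory Submission
  imports
    Defs
    "HOL-Number_Theory.Residue_Primitive_Roots"
    "HOL-Number_Theory.Modular_Inverse"
begin

text \<open>
  Write \<open>W\<^sub>n - 1 = (N\<^sub>n - D) / D\<close>. Since \<open>D\<close> has constant coefficient \<open>1\<close>, it is a unit in the
  ring of integral power series, so \<open>W\<^sub>n - 1\<close> and \<open>N\<^sub>n - D\<close> have coefficients with the same
  common divisors. Up to sign, the nonzero coefficients of \<open>N\<^sub>n - D\<close> are the numbers
  \<open>a (a\<^bsup>2n\<^esup> - 1)\<close> for odd \<open>a > 1\<close>, each at its own triangular exponent
  (\<open>dvd_W_ser_diff_iff\<close>). The content is therefore the greatest common divisor of these numbers,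
  which can be found one prime at a time.

  \<^item> At \<open>2\<close>: since \<open>a\<^sup>2 \<equiv> 1\<close> modulo \<open>8\<close>, repeated squaring gives \<open>2\<^bsup>3+v\<^esup>\<close> as a divisor of
    \<open>a\<^bsup>2n\<^esup> - 1\<close>, where \<open>v\<close> is the multiplicity of \<open>2\<close> in \<open>n\<close>. For \<open>a = 3\<close> the power is exact,
    because \<open>3\<^sup>2 = 1 + 8\<close> (\<open>odd_power_minus_one_2adic\<close>).

  \<^item> At an odd prime \<open>p\<close>: all the numbers are divisible by \<open>p\<close> iff the exponent \<open>2n\<close> kills the
    multiplicative group modulo \<open>p\<close>, which is cyclic of order \<open>p - 1\<close>
    (\<open>prime_dvd_odd_values_iff\<close>). The choice \<open>a = p\<close> shows that \<open>p\<^sup>2\<close> never divides all of them.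

  The relation to \<open>B\<^bsub>2n\<^esub>\<close> is the theorem of von Staudt and Clausen: adding \<open>1 / p\<close> for every
  prime \<open>p\<close> with \<open>p - 1\<close> dividing \<open>2n\<close> turns \<open>B\<^bsub>2n\<^esub>\<close> into an integer. Expanding
  \<open>x = ln (1 + (e\<^sup>x - 1))\<close> in powers of \<open>e\<^sup>x - 1\<close> gives \<open>B\<^sub>m = (\<Sum>k\<le>m. A\<^sub>k / (k + 1))\<close> with
  \<open>A\<^sub>k = (\<Sum>r\<le>k. (-1)\<^sup>r (k choose r) r\<^sup>m)\<close> (\<open>bernoulli_eq_sum\<close>). As \<open>A\<^sub>k\<close> is a multiple of \<open>k!\<close>, a
  term with composite \<open>k + 1 \<noteq> 4\<close> is an integer, and so is the one with \<open>k + 1 = 4\<close> for even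
  \<open>m\<close>. For prime \<open>k + 1 = p\<close>, \<open>A\<^sub>k\<close> is congruent modulo \<open>p\<close> to the sum of the \<open>m\<close>-th powers of all
  residues, that is, to \<open>-1\<close> or \<open>0\<close> according to whether \<open>p - 1\<close> divides \<open>m\<close>. A sum of
  reciprocals of distinct primes has the product of these primes as its denominator
  (\<open>den_eq_prod_primes\<close>).
\<close>

section \<open>Divisibility of the coefficients\<close>

lemma fps_const_dvd_iff:
  fixes F :: "'a::comm_semiring_1 fps"
  shows "fps_const c dvd F \<longleftrightarrow> (\<forall>k. c dvd fps_nth F k)"
proof
  assume "\<forall>k. c dvd fps_nth F k"
  then obtain h where "\<And>k. fps_nth F k = c * h k"
    unfolding dvd_def by metis
  hence "F = fps_const c * Abs_fps h"
    by (simp add: fps_eq_iff)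
  thus "fps_const c dvd F" by simp
qed (auto simp: dvd_def)

lemma N_ser_diff_nth_tri:
  "fps_nth (N_ser n - D_ser) (tri k) =
     (- 1) ^ tri k * ((2 * int k + 1) * ((2 * int k + 1) ^ (2 * n) - 1))"
proof -
  have "{j. tri j = tri k} = {k}"
    using strict_mono_eq[OF strict_mono_tri] by auto
  thus ?thesis by (simp add: N_ser_nth algebra_simps)
qed

lemma dvd_N_ser_diff_iff:
  "(\<forall>i. m dvd fps_nth (N_ser n - D_ser) i) \<longleftrightarrow>
     (\<forall>k. m dvd (2 * int k + 1) * ((2 * int k + 1) ^ (2 * n) - 1))"
proof
  assume *: "\<forall>i. m dvd fps_nth (N_ser n - D_ser) i"
  show "\<forall>k. m dvd (2 * int k + 1) * ((2 * int k + 1) ^ (2 * n) - 1)"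
  proof
    fix k
    have "is_unit ((- 1 :: int) ^ tri k)" by (simp add: is_unit_power_iff)
    thus "m dvd (2 * int k + 1) * ((2 * int k + 1) ^ (2 * n) - 1)"
      using *[rule_format, of "tri k"] unfolding N_ser_diff_nth_tri
      using dvd_mult_unit_iff' by blast
  qed
next
  assume *: "\<forall>k. m dvd (2 * int k + 1) * ((2 * int k + 1) ^ (2 * n) - 1)"
  show "\<forall>i. m dvd fps_nth (N_ser n - D_ser) i"
  proof
    fix i
    show "m dvd fps_nth (N_ser n - D_ser) i"
    proof (cases "i \<in> range tri")
      case True
      then obtain k where i: "i = tri k" by blast
      show ?thesis
        unfolding i N_ser_diff_nth_tri by (rule dvd_mult) (use * in blast)
    next
      case False
      hence "{k. tri k = i} = {}" by auto
      thus ?thesis by (simp add: N_ser_nth)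
    qed
  qed
qed

text \<open>
  The series \<open>W\<^sub>n - 1\<close> and \<open>N\<^sub>n - D = (W\<^sub>n - 1) D\<close> divide each other because \<open>D\<close> is invertible, and
  divisibility by an integer passes to multiples. This replaces the coefficients of the quotient by
  explicit numbers.
\<close>
lemma dvd_W_ser_diff_iff:
  "(\<forall>i. m dvd fps_nth (W_ser n - 1) i) \<longleftrightarrow>
     (\<forall>k. m dvd (2 * int k + 1) * ((2 * int k + 1) ^ (2 * n) - 1))"
proof -
  have inv: "D_ser * fps_right_inverse D_ser 1 = 1"
    by (rule fps_right_inverse) (simp add: N_ser_nth_0)
  have 1: "N_ser n - D_ser = (W_ser n - 1) * D_ser"
    by (simp add: algebra_simps D_mult_W)
  have 2: "W_ser n - 1 = (N_ser n - D_ser) * fps_right_inverse D_ser 1"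
    by (simp add: left_diff_distrib inv W_ser_def)
  have "fps_const m dvd W_ser n - 1 \<longleftrightarrow> fps_const m dvd N_ser n - D_ser"
    using 1 2 by (metis dvd_mult2)
  thus ?thesis
    unfolding fps_const_dvd_iff using dvd_N_ser_diff_iff by blast
qed

section \<open>Common divisors of the numbers a(a^(2n) - 1) for odd a\<close>

text \<open>
  Squaring \<open>1 + 2\<^sup>k d\<close> with \<open>k \<ge> 2\<close> gives \<open>1 + 2\<^bsup>k+1\<^esup> d'\<close> with \<open>d'\<close> of the same parity as \<open>d\<close>, and an
  odd exponent \<open>u\<close> contributes a sum of \<open>u\<close> odd terms as cofactor. The parity clause carries
  exactness along, to be used with \<open>x = 3\<close> and \<open>c = 1\<close>.
\<close>
lemma odd_power_minus_one_2adic: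
  fixes x c :: int
  assumes "odd u" "x ^ 2 = 1 + 8 * c"
  shows "\<exists>d. x ^ (2 * (2 ^ v * u)) = 1 + 2 ^ (3 + v) * d \<and> (odd c \<longrightarrow> odd d)"
proof (induction v)
  case 0
  let ?y = "x ^ 2"
  define s where "s = (\<Sum>i<u. ?y ^ i)"
  have "?y ^ u - 1 = (?y - 1) * s"
    unfolding s_def by (rule power_diff_1_eq)
  hence "x ^ (2 * (2 ^ 0 * u)) = 1 + 2 ^ (3 + 0) * (c * s)"
    using assms(2) by (simp add: power_mult)
  moreover have "odd s"
  proof -
    have "odd ?y" using assms(2) by simp
    hence "{i \<in> {..<u}. odd (?y ^ i)} = {..<u}" by auto
    thus ?thesis using assms(1) unfolding s_def by (simp add: even_sum_iff)
  qed
  ultimately show ?case by (intro exI[of _ "c * s"]) simp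
next
  case (Suc v)
  then obtain d where d: "x ^ (2 * (2 ^ v * u)) = 1 + 2 ^ (3 + v) * d" "odd c \<longrightarrow> odd d"
    by blast
  have "x ^ (2 * (2 ^ Suc v * u)) = (x ^ (2 * (2 ^ v * u))) ^ 2"
    by (simp add: power_mult [symmetric] mult_ac)
  also have "\<dots> = 1 + 2 ^ (3 + Suc v) * (d + 2 ^ (2 + v) * d ^ 2)"
    unfolding d(1) by (simp add: power2_eq_square algebra_simps power_add)
  finally show ?case using d(2) by (intro exI[of _ "d + 2 ^ (2 + v) * d ^ 2"]) simp
qed

text \<open>
  Fermat's little theorem gives one direction, the order of a primitive root the other.
\<close>
lemma fermat_exponent_iff:
  fixes p k :: nat
  assumes p: "prime p"
  shows "(\<forall>a. \<not> p dvd a \<longrightarrow> [a ^ k = 1] (mod p)) \<longleftrightarrow> p - 1 dvd k"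
proof
  assume *: "\<forall>a. \<not> p dvd a \<longrightarrow> [a ^ k = 1] (mod p)"
  obtain g where "residue_primroot p g"
    using prime_primitive_root_exists[OF prime_gt_1_nat[OF p] p] ..
  hence g: "coprime p g" "ord p g = p - 1"
    using p by (auto simp: residue_primroot_def totient_prime)
  have "\<not> p dvd g"
    using g(1) p coprime_absorb_left not_prime_unit by blast
  hence "[g ^ k = 1] (mod p)" using * by blast
  thus "p - 1 dvd k" using g(2) by (metis ord_divides)
next
  assume "p - 1 dvd k"
  then obtain j where j: "k = (p - 1) * j" by auto
  show "\<forall>a. \<not> p dvd a \<longrightarrow> [a ^ k = 1] (mod p)"
    using cong_pow[OF fermat_theorem[OF p], of _ j] by (auto simp: j power_mult)
qed

lemma prime_dvd_odd_values_iff: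
  fixes p n :: nat
  assumes p: "prime p" "odd p"
  shows "(\<forall>k. int p dvd (2 * int k + 1) * ((2 * int k + 1) ^ (2 * n) - 1)) \<longleftrightarrow> p - 1 dvd 2 * n"
proof -
  have pi: "prime (int p)" using p by simp
  have c: "int p dvd int a ^ (2 * n) - 1 \<longleftrightarrow> [a ^ (2 * n) = 1] (mod p)" for a
    using cong_int_iff[of "a ^ (2 * n)" 1 p] by (simp add: cong_iff_dvd_diff)
  have "(\<forall>k. int p dvd (2 * int k + 1) * ((2 * int k + 1) ^ (2 * n) - 1)) \<longleftrightarrow>
        (\<forall>a. odd a \<longrightarrow> int p dvd int a * (int a ^ (2 * n) - 1))"
  proof safe
    fix a :: nat
    assume *: "\<forall>k. int p dvd (2 * int k + 1) * ((2 * int k + 1) ^ (2 * n) - 1)" and "odd a"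
    then obtain k where "a = 2 * k + 1" by (auto elim: oddE)
    hence "int a = 2 * int k + 1" by simp
    thus "int p dvd int a * (int a ^ (2 * n) - 1)" using * by (simp only:)
  next
    fix k
    assume *: "\<forall>a. odd a \<longrightarrow> int p dvd int a * (int a ^ (2 * n) - 1)"
    show "int p dvd (2 * int k + 1) * ((2 * int k + 1) ^ (2 * n) - 1)"
      using *[rule_format, of "2 * k + 1"] by (simp add: add.commute)
  qed
  also have "\<dots> \<longleftrightarrow> (\<forall>a. odd a \<longrightarrow> \<not> p dvd a \<longrightarrow> [a ^ (2 * n) = 1] (mod p))"
    using pi by (auto simp: prime_dvd_mult_iff c)
  also have "\<dots> \<longleftrightarrow> (\<forall>a. \<not> p dvd a \<longrightarrow> [a ^ (2 * n) = 1] (mod p))"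
  proof safe
    fix a
    assume *: "\<forall>a. odd a \<longrightarrow> \<not> p dvd a \<longrightarrow> [a ^ (2 * n) = 1] (mod p)" and a: "\<not> p dvd a"
    show "[a ^ (2 * n) = 1] (mod p)"
    \<comment> \<open>As \<open>p\<close> is odd, every residue class modulo \<open>p\<close> has an odd representative.\<close>
    proof (cases "odd a")
      case False
      have "[a ^ (2 * n) = (a + p) ^ (2 * n)] (mod p)"
        by (intro cong_pow) (simp add: cong_def)
      moreover have "[(a + p) ^ (2 * n) = 1] (mod p)"
        using * a p(2) False by simp
      ultimately show ?thesis by (rule cong_trans)
    qed (use * a in blast)
  qed auto
  finally show ?thesis using fermat_exponent_iff[OF p(1)] by simp
qed

text \<open>
  The prime powers that make up the modulus are pairwise coprime, so they can be checked separately.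
\<close>
lemma g_mod_dvd_odd_values:
  assumes n: "n \<ge> 1"
  shows "int (g_mod n) dvd (2 * int k + 1) * ((2 * int k + 1) ^ (2 * n) - 1)" (is "_ dvd ?v")
proof -
  let ?P = "{p :: nat. prime p \<and> odd p \<and> (p - 1) dvd 2 * n}"
  define v where "v = multiplicity 2 n"
  obtain u where u: "n = 2 ^ v * u" "odd u"
    using multiplicity_decompose'[of n 2] n unfolding v_def by auto
  \<comment> \<open>An odd square is \<open>1 + 8 c\<close>, where \<open>c\<close> is a triangular number.\<close>
  have "even (k * (k + 1))" by simp
  then obtain c where "k * (k + 1) = 2 * c" by (elim evenE)
  hence "int k * (int k + 1) = 2 * int c"
    by (metis of_nat_1 of_nat_add of_nat_mult of_nat_numeral)
  hence "(2 * int k + 1) ^ 2 = 1 + 8 * int c"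
    by (simp add: power2_eq_square algebra_simps)
  from odd_power_minus_one_2adic[OF u(2) this, of v]
  have two: "2 ^ (3 + v) dvd ?v"
    using u(1) by auto
  have odd: "(\<Prod>p\<in>?P. int p) dvd ?v"
  proof -
    have "[?v = 0] (mod (\<Prod>p\<in>?P. int p))"
    proof (rule cong_cong_prod_coprime)
      show "\<forall>p\<in>?P. [?v = 0] (mod int p)"
        using prime_dvd_odd_values_iff by (auto simp: cong_0_iff)
      show "\<forall>p\<in>?P. \<forall>q\<in>?P. p \<noteq> q \<longrightarrow> coprime (int p) (int q)"
        by (auto simp: primes_coprime)
    qed
    thus ?thesis by (simp add: cong_0_iff)
  qed
  have "coprime (2 ^ (3 + v)) (\<Prod>p\<in>?P. int p)"
    by (intro prod_coprime_right) auto
  from divides_mult[OF two odd this] show ?thesis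
    by (simp add: g_mod_def v_def)
qed

text \<open>
  One well chosen odd \<open>a\<close> bounds the multiplicity of each prime in a common divisor: \<open>a = 3\<close> for
  the prime \<open>2\<close>, since the \<open>2\<close>-part of \<open>9\<^sup>n - 1\<close> is exactly \<open>2\<^bsup>3+v\<^esup>\<close>, and \<open>a = p\<close> for an odd prime
  \<open>p\<close>, since \<open>p\<^bsup>2n\<^esup> - 1\<close> is prime to \<open>p\<close>.
\<close>
lemma odd_values_common_divisor_dvd_g_mod:
  fixes m :: nat
  assumes n: "n \<ge> 1"
    and m: "\<And>k. int m dvd (2 * int k + 1) * ((2 * int k + 1) ^ (2 * n) - 1)"
  shows "m dvd g_mod n"
proof (rule multiplicity_le_imp_dvd)
  let ?P = "{p :: nat. prime p \<and> odd p \<and> (p - 1) dvd 2 * n}"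
  define v where "v = multiplicity 2 n"
  obtain u where u: "n = 2 ^ v * u" "odd u"
    using multiplicity_decompose'[of n 2] n unfolding v_def by auto
  obtain d where d: "(3 :: int) ^ (2 * n) = 1 + 2 ^ (3 + v) * d" "odd d"
    using odd_power_minus_one_2adic[OF u(2), of 3 1 v] u(1) by auto
  have m3: "int m dvd 2 ^ (3 + v) * (3 * d)"
    using m[of 1] d(1) by (simp add: mult_ac)
  have "d \<noteq> 0" using d(2) by auto
  thus "m \<noteq> 0" using m3 by (intro notI) simp
  have fin: "finite ?P" using finite_g_mod_primes[OF n] .
  have g: "g_mod n = 2 ^ (3 + v) * \<Prod>?P" by (simp add: g_mod_def v_def)
  have g0: "g_mod n \<noteq> 0" using fin by (auto simp: g)
  fix p :: nat
  assume p: "prime p"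
  define e where "e = multiplicity p m"
  have pe: "int p ^ e dvd int m"
    unfolding e_def by (metis int_dvd_int_iff multiplicity_dvd of_nat_power)
  have "p ^ e dvd g_mod n"
  proof (cases "p = 2")
    case True
    have "coprime (2 ^ e) (3 * d)" using d(2) by simp
    moreover have "2 ^ e dvd 2 ^ (3 + v) * (3 * d)"
      using pe m3 True dvd_trans by auto
    ultimately have "(2 :: int) ^ e dvd 2 ^ (3 + v)"
      by (simp add: coprime_dvd_mult_left_iff)
    hence "(2 :: nat) ^ e dvd 2 ^ (3 + v)"
      by (metis int_dvd_int_iff of_nat_numeral of_nat_power)
    thus ?thesis using True by (simp add: g)
  next
    case False
    hence odd: "odd p" using p primes_dvd_imp_eq two_is_prime_nat by blast
    show ?thesis
    proof (cases "e = 0")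
      case False
      hence "int p dvd int m" using power_le_dvd[OF pe, of 1] by simp
      hence "p - 1 dvd 2 * n"
        using prime_dvd_odd_values_iff[OF p odd] m dvd_trans by blast
      hence "p \<in> ?P" using p odd by simp
      have "e \<le> 1"
      proof (rule ccontr)
        assume "\<not> e \<le> 1"
        hence "int p ^ 2 dvd int m" by (intro power_le_dvd[OF pe]) simp
        moreover obtain k where "p = 2 * k + 1" using odd by (auto elim: oddE)
        hence "int p = 2 * int k + 1" by simp
        hence "int m dvd int p * (int p ^ (2 * n) - 1)" using m[of k] by (simp only:)
        ultimately have "int p ^ 2 dvd int p * (int p ^ (2 * n) - 1)" by (rule dvd_trans)
        hence "int p dvd int p ^ (2 * n) - 1"
          using p by (simp add: power2_eq_square)
        moreover have "int p dvd int p ^ (2 * n)" using n by simp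
        ultimately have "int p dvd 1" by (simp add: dvd_diff_right_iff)
        thus False using p by (auto dest: prime_gt_1_nat)
      qed
      hence "p ^ e = p" using False by (simp add: le_Suc_eq)
      moreover have "p dvd \<Prod>?P" using \<open>p \<in> ?P\<close> fin by auto
      ultimately show ?thesis by (simp add: g)
    qed simp
  qed
  thus "multiplicity p m \<le> multiplicity p (g_mod n)"
    using g0 p unfolding e_def by (intro multiplicity_geI) auto
qed

section \<open>Alternating binomial power sums\<close>

text \<open>
  Up to the sign \<open>(-1)\<^sup>k\<close>, this is the \<open>k\<close>-th finite difference of \<open>r\<^sup>m\<close> at \<open>0\<close>, that is, \<open>k!\<close> times a
  Stirling number of the second kind.
\<close>
definition alt_power_sum :: "nat \<Rightarrow> nat \<Rightarrow> int" where
  "alt_power_sum m k = (\<Sum>r\<le>k. (- 1) ^ r * int (k choose r) * int r ^ m)"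

text \<open>
  This comes from the absorption rule \<open>r (k choose r) = k (k - 1 choose r - 1)\<close>. The factor on the
  right accumulates to \<open>k!\<close> in \<open>fact_dvd_alt_power_sum\<close>.
\<close>
lemma alt_power_sum_rec:
  "alt_power_sum (Suc m) (Suc k) = int (Suc k) * (alt_power_sum m (Suc k) - alt_power_sum m k)"
proof -
  have absorb: "int (Suc k choose r) * int r = int (Suc k) * (int (Suc k choose r) - int (k choose r))" for r
  proof (cases r)
    case (Suc j)
    have "int (Suc j) * int (Suc k choose Suc j) = int (Suc k) * int (k choose j)"
      by (metis Suc_times_binomial_eq of_nat_mult mult.commute)
    thus ?thesis by (simp add: Suc algebra_simps)
  qed simp
  have "alt_power_sum (Suc m) (Suc k) =
      (\<Sum>r\<le>Suc k. (- 1) ^ r * int r ^ m * (int (Suc k choose r) * int r))"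
    by (simp add: alt_power_sum_def mult_ac)
  also have "\<dots> = int (Suc k) * (alt_power_sum m (Suc k) -
      (\<Sum>r\<le>Suc k. (- 1) ^ r * int (k choose r) * int r ^ m))"
    unfolding absorb alt_power_sum_def sum_subtractf [symmetric] sum_distrib_left
    by (intro sum.cong) (simp_all add: algebra_simps)
  also have "(\<Sum>r\<le>Suc k. (- 1) ^ r * int (k choose r) * int r ^ m) = alt_power_sum m k"
    by (simp add: alt_power_sum_def)
  finally show ?thesis .
qed

lemma fact_dvd_alt_power_sum: "fact k dvd alt_power_sum m k"
proof (induction m arbitrary: k)
  case 0
  have "alt_power_sum 0 k = (\<Sum>r\<le>k. (- 1) ^ r * int (k choose r))"
    by (simp add: alt_power_sum_def)
  also have "\<dots> = 0" if "k > 0"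
    using choose_alternating_sum[OF that, where ?'a = int] by simp
  finally show ?case by (cases "k = 0") auto
next
  case (Suc m)
  show ?case
  proof (cases k)
    case (Suc j)
    have "fact j dvd alt_power_sum m (Suc j) - alt_power_sum m j"
      using Suc.IH[of j] Suc.IH[of "Suc j"] by (intro dvd_diff) (auto intro: dvd_trans[OF fact_dvd])
    thus ?thesis unfolding Suc alt_power_sum_rec fact_Suc of_nat_id
      by (intro mult_dvd_mono) auto
  qed simp
qed

lemma composite_dvd_fact:
  fixes n :: nat
  assumes "\<not> prime n" "n > 1" "n \<noteq> 4"
  shows "n dvd fact (n - 1)"
proof -
  obtain a b where ab: "n = a * b" "1 < a" "1 < b"
  proof -
    obtain a where a: "a dvd n" "a \<noteq> 1" "a \<noteq> n"
      using assms(1,2) by (auto simp: prime_nat_iff)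
    then obtain b where "n = a * b" by blast
    moreover from this have "0 < a" "0 < b" "b \<noteq> 1" using assms(2) a(3) by (auto intro: Nat.gr0I)
    ultimately show ?thesis using a(2) by (intro that[of a b]) auto
  qed
  have mul: "a * b dvd fact (n - 1)" if "0 < a" "a < b" "b < n" for a b
  proof -
    have "a dvd fact (b - 1)" using that by (intro dvd_fact) auto
    hence "a * b dvd fact (b - 1) * b" by (rule mult_dvd_mono) simp
    also have "fact (b - 1) * b = fact b" using that by (simp add: fact_reduce mult.commute)
    also have "fact b dvd (fact (n - 1) :: nat)" using that by (intro fact_dvd) auto
    finally show ?thesis .
  qed
  have lt: "a < n" "b < n" using ab by auto
  consider "a < b" | "b < a" | "a = b" by linarith
  thus ?thesis
  proof cases
    case 3
    \<comment> \<open>A square \<open>a\<^sup>2 > 4\<close> divides the product of the two factors \<open>a < 2 a\<close> of the factorial.\<close>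
    have "a \<noteq> 2" using ab 3 assms(3) by auto
    hence "2 * a < n" using ab 3 by auto
    hence "a * (2 * a) dvd fact (n - 1)" using ab by (intro mul) auto
    moreover have "n dvd a * (2 * a)" using ab 3 by simp
    ultimately show ?thesis by (rule dvd_trans[rotated])
  qed (use mul[of a b] mul[of b a] ab lt in \<open>auto simp: mult.commute\<close>)
qed

text \<open>
  Two neighbouring entries of row \<open>p - 1\<close> of Pascal's triangle add up to an inner entry of row \<open>p\<close>,
  which is a multiple of \<open>p\<close>. The signs thus alternate along the row.
\<close>
lemma choose_prime_minus_one_cong:
  assumes p: "prime p" and "r < p"
  shows "[int ((p - 1) choose r) = (- 1) ^ r] (mod int p)"
  using assms(2)
proof (induction r)
  case (Suc r)
  have "p choose Suc r = ((p - 1) choose r) + ((p - 1) choose Suc r)"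
    using p by (cases p) auto
  moreover have "p dvd (p choose Suc r)"
    using Suc.prems p by (intro dvd_choose_prime) auto
  ultimately have "int p dvd int ((p - 1) choose r) + int ((p - 1) choose Suc r)"
    by (metis int_dvd_int_iff of_nat_add)
  moreover have "int p dvd int ((p - 1) choose r) - (- 1) ^ r"
    using Suc by (simp add: cong_iff_dvd_diff)
  ultimately have "int p dvd (int ((p - 1) choose r) + int ((p - 1) choose Suc r))
      - (int ((p - 1) choose r) - (- 1) ^ r)" by (rule dvd_diff)
  thus ?case by (simp add: cong_iff_dvd_diff)
qed simp

text \<open>
  If \<open>p - 1\<close> divides \<open>m\<close>, all \<open>p - 1\<close> summands are \<open>1\<close>. Otherwise some unit \<open>g\<close> has \<open>g\<^sup>m \<noteq> 1\<close>;
  multiplication by \<open>g\<close> permutes the nonzero residues, so the sum \<open>S\<close> satisfies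
  \<open>g\<^sup>m S = S\<close> and must vanish.
\<close>
lemma prime_power_sum_cong:
  assumes p: "prime p"
  shows "[(\<Sum>x\<in>{1..<int p}. x ^ m) = - of_bool (p - 1 dvd m)] (mod int p)"
proof (cases "p - 1 dvd m")
  case True
  have "[(\<Sum>x\<in>{1..<int p}. x ^ m) = (\<Sum>x\<in>{1..<int p}. 1)] (mod int p)"
  proof (rule cong_sum)
    fix x assume x: "x \<in> {1..<int p}"
    hence "\<not> p dvd nat x" by (auto dest!: dvd_imp_le)
    hence "[nat x ^ m = 1] (mod p)" using fermat_exponent_iff[OF p] True by blast
    hence "[int (nat x ^ m) = int 1] (mod int p)" by (simp only: cong_int_iff)
    thus "[x ^ m = 1] (mod int p)" using x by simp
  qed
  also have "(\<Sum>x\<in>{1..<int p}. 1) = int p - 1" using prime_gt_1_nat[OF p] by simp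
  also have "[int p - 1 = - 1] (mod int p)" by (simp add: cong_iff_dvd_diff)
  finally show ?thesis using True by simp
next
  case False
  then obtain g where g: "\<not> p dvd g" "\<not> [g ^ m = 1] (mod p)"
    using fermat_exponent_iff[OF p] by blast
  have "coprime (int g) (int p)"
    using prime_imp_coprime[OF p g(1)] by (simp add: coprime_commute)
  note bij = bij_betw_int_remainders_mult[OF this]
  let ?S = "\<Sum>x\<in>{1..<int p}. x ^ m"
  have "?S = (\<Sum>x\<in>{1..<int p}. (int g * x mod int p) ^ m)"
    using sum.reindex_bij_betw[OF bij, of "\<lambda>x. x ^ m"] by simp
  also have "[\<dots> = (\<Sum>x\<in>{1..<int p}. (int g * x) ^ m)] (mod int p)"
    by (intro cong_sum cong_pow) (simp add: cong_def)
  also have "(\<Sum>x\<in>{1..<int p}. (int g * x) ^ m) = int g ^ m * ?S"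
    by (simp add: power_mult_distrib sum_distrib_left)
  finally have "int p dvd (int g ^ m - 1) * ?S"
    by (simp add: cong_iff_dvd_diff left_diff_distrib dvd_diff_commute)
  moreover have "\<not> int p dvd int g ^ m - 1"
    using g(2) cong_int_iff[of "g ^ m" 1 p] by (simp add: cong_iff_dvd_diff)
  ultimately have "int p dvd ?S" using p by (simp add: prime_dvd_mult_iff)
  thus ?thesis using False by (simp add: cong_0_iff)
qed

lemma alt_power_sum_prime_cong:
  assumes p: "prime p" and m: "m > 0"
  shows "[alt_power_sum m (p - 1) = - of_bool (p - 1 dvd m)] (mod int p)"
proof -
  have p0: "p > 1" using prime_gt_1_nat[OF p] .
  have "[alt_power_sum m (p - 1) = (\<Sum>r\<le>p - 1. (- 1) ^ r * (- 1) ^ r * int r ^ m)] (mod int p)"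
    unfolding alt_power_sum_def
    using p0 by (intro cong_sum cong_mult choose_prime_minus_one_cong p cong_refl) auto
  also have "(\<Sum>r\<le>p - 1. (- 1) ^ r * (- 1) ^ r * int r ^ m) = (\<Sum>r\<le>p - 1. int r ^ m)"
    by (simp flip: power_mult_distrib)
  also have "\<dots> = (\<Sum>r\<in>{1..<p}. int r ^ m)"
    using m p0 by (intro sum.mono_neutral_right) (auto simp: not_le)
  also have "\<dots> = (\<Sum>x\<in>{1..<int p}. x ^ m)"
    by (intro sum.reindex_bij_witness[of _ nat int]) auto
  also note prime_power_sum_cong[OF p]
  finally show ?thesis .
qed

text \<open>
  Each term of the expansion of the Bernoulli number becomes an integer after the correction by
  \<open>1 / p\<close>. The only case that depends on the parity of \<open>m\<close> is \<open>k + 1 = 4\<close>, where \<open>3! = 6\<close> misses a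
  factor \<open>2\<close>: the sum is \<open>3 \<cdot> 2\<^sup>m - 3\<^sup>m - 3\<close>, and \<open>3\<^sup>m \<equiv> 1\<close> modulo \<open>4\<close> for even \<open>m\<close>.
\<close>
lemma Suc_dvd_alt_power_sum_plus:
  assumes m: "m > 0" "even m"
  shows "int (Suc k) dvd alt_power_sum m k + of_bool (prime (Suc k) \<and> k dvd m)"
proof -
  consider "prime (Suc k)" | "k = 0" | "k = 3" | "\<not> prime (Suc k)" "Suc k > 1" "Suc k \<noteq> 4"
    by fastforce
  thus ?thesis
  proof cases
    case 1
    thus ?thesis using alt_power_sum_prime_cong[OF 1 m(1)] by (simp add: cong_iff_dvd_diff)
  next
    case 3
    obtain j where j: "m = 2 * j" using m(2) by (elim evenE)
    have three: "[(3 :: int) ^ m = 1] (mod 4)"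
      unfolding j power_mult using cong_pow[of "3\<^sup>2 :: int" 1 4 j] by (simp add: cong_def)
    have "2 \<le> m" using m by (auto elim!: evenE)
    hence "(2 :: int) ^ 2 dvd 2 ^ m" by (rule le_imp_power_dvd)
    hence "4 dvd 3 * 2 ^ m - ((3 :: int) ^ m - 1)"
      using three by (intro dvd_diff[OF dvd_mult]) (simp_all add: cong_iff_dvd_diff)
    hence "4 dvd 3 * 2 ^ m - ((3 :: int) ^ m - 1) - 4" by (rule dvd_diff) simp
    moreover have "alt_power_sum m 3 = 3 * 2 ^ m - (3 ^ m - 1) - 4"
      using m by (simp add: alt_power_sum_def numeral_eq_Suc)
    moreover have "\<not> prime (4 :: nat)" using prime_nat_iff[of 4] by (auto intro!: exI[of _ 2] dest: spec[of _ 2])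
    ultimately show ?thesis using 3 by simp
  next
    case 4
    have "Suc k dvd fact k" using composite_dvd_fact[of "Suc k"] 4 by simp
    hence "int (Suc k) dvd int (fact k)" by (simp only: int_dvd_int_iff)
    hence "int (Suc k) dvd fact k" by (simp only: of_nat_fact)
    hence "int (Suc k) dvd alt_power_sum m k"
      using fact_dvd_alt_power_sum dvd_trans by blast
    thus ?thesis using 4(1) by simp
  qed simp
qed

section \<open>The theorem of von Staudt and Clausen\<close>

lemma fps_exp_minus_one_power_nth:
  "fps_nth ((fps_exp 1 - 1) ^ k :: rat fps) m = (- 1) ^ k * of_int (alt_power_sum m k) / fact m"
proof -
  have "(fps_exp 1 - 1 :: rat fps) ^ k = (\<Sum>r\<le>k. of_nat (k choose r) * fps_exp 1 ^ r * (- 1) ^ (k - r))"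
    using binomial_ring[of "fps_exp 1 :: rat fps" "- 1" k] by simp
  also have "\<dots> = (\<Sum>r\<le>k. fps_const ((- 1) ^ k * (- 1) ^ r * of_nat (k choose r)) * fps_exp (of_nat r))"
  proof (rule sum.cong)
    fix r assume "r \<in> {..k}"
    hence "(- 1 :: rat fps) ^ (k - r) = (- 1) ^ k * (- 1) ^ r"
      by (auto simp: uminus_power_if)
    moreover have "fps_const ((- 1 :: rat) ^ j) = (- 1) ^ j" for j
      by (simp flip: fps_const_power fps_const_neg)
    ultimately show "of_nat (k choose r) * fps_exp 1 ^ r * (- 1) ^ (k - r) =
        fps_const ((- 1) ^ k * (- 1) ^ r * of_nat (k choose r)) * fps_exp (of_nat r :: rat)"
      by (simp add: fps_exp_power_mult fps_of_nat mult_ac flip: fps_const_mult)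
  qed simp
  finally show ?thesis
    by (simp add: fps_sum_nth alt_power_sum_def sum_distrib_left sum_divide_distrib mult_ac)
qed

text \<open>
  Let \<open>E = e\<^sup>x - 1\<close> and \<open>ln (1 + y) = y L(y)\<close>. Substituting \<open>E\<close> for \<open>y\<close> gives \<open>x = E L(E)\<close>. Hence \<open>L(E)\<close> is
  the generating function \<open>x / E\<close> of the Bernoulli numbers, and its coefficients can be
  read off from those of the powers of \<open>E\<close>.
\<close>
lemma bernoulli_eq_sum:
  "bernoulli m = (\<Sum>k\<le>m. of_int (alt_power_sum m k) / of_nat (Suc k))"
proof -
  let ?E = "fps_exp 1 - 1 :: rat fps"
  define L :: "rat fps" where "L = Abs_fps (\<lambda>k. (- 1) ^ k / of_nat (Suc k))"
  have ln: "fps_ln 1 = fps_X * L"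
    by (simp add: fps_eq_iff fps_ln_nth L_def)
  have E0: "fps_nth ?E 0 = 0" by simp
  have "fps_X = fps_ln 1 oo ?E"
    unfolding fps_ln_fps_exp_inv[OF one_neq_zero] by (rule fps_inv [symmetric]) simp_all
  also have "\<dots> = ?E * (L oo ?E)"
    unfolding ln fps_compose_mult_distrib[OF E0] by (simp add: fps_X_fps_compose_startby0)
  finally have "?E * (L oo ?E) = ?E * Abs_fps (\<lambda>j. bernoulli j / fact j)"
    using bernoulli_fps_mult by simp
  moreover have "?E \<noteq> 0"
  proof
    assume "?E = 0"
    hence "fps_nth ?E 1 = 0" by (simp only: fps_zero_nth)
    thus False by simp
  qed
  ultimately have "L oo ?E = Abs_fps (\<lambda>j. bernoulli j / fact j)"
    by simp
  hence "bernoulli m = fact m * fps_nth (L oo ?E) m" by simp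
  also have "\<dots> = (\<Sum>k\<le>m. of_int (alt_power_sum m k) / of_nat (Suc k))"
    unfolding fps_compose_nth fps_exp_minus_one_power_nth sum_distrib_left atLeast0AtMost
    by (intro sum.cong) (auto simp: L_def simp flip: power_mult_distrib)
  finally show ?thesis .
qed

theorem von_staudt_clausen:
  assumes m: "m > 0" "even m"
  shows "bernoulli m + (\<Sum>p | prime p \<and> p - 1 dvd m. 1 / of_nat p) \<in> \<int>"
proof -
  let ?P = "{p. prime p \<and> p - 1 dvd m}"
  have "(\<Sum>p\<in>?P. 1 / of_nat p :: rat) = (\<Sum>k | k \<le> m \<and> prime (Suc k) \<and> k dvd m. 1 / of_nat (Suc k))"
    using m(1) by (intro sum.reindex_bij_witness[of _ Suc "\<lambda>p. p - 1"])
      (auto dest: dvd_imp_le simp: prime_gt_0_nat)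
  also have "\<dots> = (\<Sum>k\<le>m. of_bool (prime (Suc k) \<and> k dvd m) / of_nat (Suc k))"
    by (intro sum.mono_neutral_cong_left) auto
  finally have "bernoulli m + (\<Sum>p\<in>?P. 1 / of_nat p) =
      (\<Sum>k\<le>m. (of_int (alt_power_sum m k) + of_bool (prime (Suc k) \<and> k dvd m)) / of_nat (Suc k))"
    by (simp only: bernoulli_eq_sum sum.distrib [symmetric] add_divide_distrib)
  also have "\<dots> \<in> \<int>"
  proof (rule Ints_sum)
    fix k
    obtain z where "alt_power_sum m k + of_bool (prime (Suc k) \<and> k dvd m) = int (Suc k) * z"
      using Suc_dvd_alt_power_sum_plus[OF m] by (auto elim: dvdE)
    hence "of_int (alt_power_sum m k + of_bool (prime (Suc k) \<and> k dvd m)) = (of_int (int (Suc k) * z) :: rat)"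
      by (rule arg_cong)
    hence "of_int (alt_power_sum m k) + of_bool (prime (Suc k) \<and> k dvd m) = (of_nat (Suc k) * of_int z :: rat)"
      by (simp only: of_int_add of_int_mult of_int_of_bool of_int_of_nat_eq)
    thus "(of_int (alt_power_sum m k) + of_bool (prime (Suc k) \<and> k dvd m)) / of_nat (Suc k) \<in> (\<int> :: rat set)"
      by (simp del: of_nat_Suc)
  qed
  finally show ?thesis .
qed

text \<open>
  Over the common denominator \<open>\<Prod>P\<close>, each \<open>p \<in> P\<close> divides every summand of the numerator except
  the one belonging to \<open>1 / p\<close>, so the fraction is in lowest terms.
\<close>
lemma den_eq_prod_primes:
  assumes fin: "finite P" and P: "\<And>p. p \<in> P \<Longrightarrow> prime (p :: nat)"
    and x: "x + (\<Sum>p\<in>P. 1 / of_nat p) \<in> \<int>"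
  shows "den x = int (\<Prod>P)"
proof -
  define Q where "Q = int (\<Prod>P)"
  define s where "s = (\<Sum>p\<in>P. \<Prod>q\<in>P - {p}. int q)"
  have Q0: "Q > 0" unfolding Q_def using P by (auto intro!: prod_pos prime_gt_0_nat)
  obtain z where z: "x + (\<Sum>p\<in>P. 1 / of_nat p) = of_int z"
    using x by (auto elim: Ints_cases)
  have Qp: "Q = int p * (\<Prod>q\<in>P - {p}. int q)" if "p \<in> P" for p
    using prod.remove[OF fin that, of int] by (simp add: Q_def)
  have "(\<Sum>p\<in>P. 1 / of_nat p) = (of_int s / of_int Q :: rat)"
    unfolding s_def of_int_sum sum_divide_distrib
  proof (rule sum.cong)
    fix p assume p: "p \<in> P"
    have "(\<Prod>q\<in>P - {p}. int q) \<noteq> 0"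
      using P fin by (auto dest: prime_gt_0_nat)
    hence "(of_int (\<Prod>q\<in>P - {p}. int q) :: rat) \<noteq> 0" by (simp only: of_int_eq_0_iff not_False_eq_True)
    thus "1 / of_nat p = (of_int (\<Prod>q\<in>P - {p}. int q) / of_int Q :: rat)"
      unfolding Qp[OF p] of_int_mult by simp
  qed simp
  hence "x = of_int z - of_int s / of_int Q" using z by (simp add: algebra_simps)
  hence "x = of_int (z * Q - s) / of_int Q" using Q0 by (simp add: field_simps)
  hence xF: "x = Rat.Fract (z * Q - s) Q" by (simp only: Fract_of_int_quotient)
  have "coprime (z * Q - s) (int p)" if p: "p \<in> P" for p
  proof -
    have "\<not> int p dvd z * Q - s"
    proof
      assume "int p dvd z * Q - s"
      moreover have "int p dvd z * Q" using Qp[OF p] by simp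
      ultimately have "int p dvd s" by (simp add: dvd_diff_right_iff)
      moreover have "s = (\<Prod>q\<in>P - {p}. int q) + (\<Sum>r\<in>P - {p}. \<Prod>q\<in>P - {r}. int q)"
        unfolding s_def by (rule sum.remove[OF fin p])
      moreover have "int p dvd (\<Sum>r\<in>P - {p}. \<Prod>q\<in>P - {r}. int q)"
        using fin p by (intro dvd_sum dvd_prodI) auto
      ultimately have "int p dvd (\<Prod>q\<in>P - {p}. int q)" by (simp add: dvd_add_left_iff)
      then obtain q where "q \<in> P - {p}" "p dvd q"
        using fin P[OF p] by (auto simp: prime_dvd_prod_iff)
      thus False using P p primes_dvd_imp_eq by blast
    qed
    hence "coprime (int p) (z * Q - s)" using P[OF p] by (intro prime_imp_coprime) auto
    thus ?thesis by (simp add: coprime_commute)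
  qed
  hence "coprime (z * Q - s) Q"
    unfolding Q_def of_nat_prod by (intro prod_coprime_right) auto
  thus ?thesis
    using Q0 by (simp add: den_def xF quotient_of_Fract Q_def)
qed

lemma den_bernoulli:
  assumes "m > 0" "even m"
  shows "den (bernoulli m) = int (\<Prod>{p. prime p \<and> p - 1 dvd m})"
proof (rule den_eq_prod_primes)
  show "finite {p :: nat. prime p \<and> p - 1 dvd m}"
  proof (rule finite_subset)
    show "{p :: nat. prime p \<and> p - 1 dvd m} \<subseteq> {..m + 1}"
      using assms(1) by (auto dest!: dvd_imp_le)
  qed simp
qed (use von_staudt_clausen[OF assms] in auto)

lemma g_mod_eq_den_bernoulli:
  assumes n: "n \<ge> 1"
  shows "int (g_mod n) = 2 ^ (2 + multiplicity 2 n) * den (bernoulli (2 * n))"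
proof -
  let ?P = "{p :: nat. prime p \<and> odd p \<and> (p - 1) dvd 2 * n}"
  have "{p :: nat. prime p \<and> p - 1 dvd 2 * n} = insert 2 ?P"
    using primes_dvd_imp_eq[OF two_is_prime_nat] by auto
  hence "den (bernoulli (2 * n)) = 2 * int (\<Prod>?P)"
    using den_bernoulli[of "2 * n"] n finite_g_mod_primes[OF n] by simp
  thus ?thesis by (simp add: g_mod_def power_add)
qed

section \<open>The content of the quotient\<close>

theorem theorem6p2:
  fixes n :: nat
  assumes "n \<ge> 1"
  shows "W_ser n - 1 \<noteq> 0 \<and> cont (W_ser n - 1) = int (g_mod n)
    \<and> (\<forall>k. [fps_nth (W_ser n) k = fps_nth 1 k] (mod int (g_mod n)))
    \<and> (\<forall>m :: int. (\<forall>k. [fps_nth (W_ser n) k = fps_nth 1 k] (mod m)) \<longrightarrow> m dvd int (g_mod n))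
    \<and> int (g_mod n) = 2 ^ (2 + multiplicity 2 n) * den (bernoulli (2 * n))"
proof -
  have cong_iff: "(\<forall>k. [fps_nth (W_ser n) k = fps_nth 1 k] (mod m)) \<longleftrightarrow>
      (\<forall>k. m dvd fps_nth (W_ser n - 1) k)" for m :: int
    by (simp add: cong_iff_dvd_diff)
  have g_dvd: "\<forall>k. int (g_mod n) dvd fps_nth (W_ser n - 1) k"
    unfolding dvd_W_ser_diff_iff using g_mod_dvd_odd_values[OF assms] by blast
  have best: "m dvd int (g_mod n)" if "\<forall>k. m dvd fps_nth (W_ser n - 1) k" for m
  proof -
    have "\<forall>k. m dvd (2 * int k + 1) * ((2 * int k + 1) ^ (2 * n) - 1)"
      using that unfolding dvd_W_ser_diff_iff .
    hence "nat \<bar>m\<bar> dvd g_mod n"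
      by (intro odd_values_common_divisor_dvd_g_mod[OF assms]) simp
    thus ?thesis by simp
  qed
  have nz: "W_ser n - 1 \<noteq> 0"
  proof
    assume "W_ser n - 1 = 0"
    \<comment> \<open>The zero series would have \<open>0\<close> as a common divisor of its coefficients.\<close>
    hence "0 dvd int (g_mod n)" by (intro best) simp
    thus False using finite_g_mod_primes[OF assms] by (auto simp: g_mod_def)
  qed
  have "Gcd (range (fps_nth (W_ser n - 1))) = int (g_mod n)"
  proof (rule zdvd_antisym_nonneg)
    show "Gcd (range (fps_nth (W_ser n - 1))) dvd int (g_mod n)"
      by (intro best) auto
    show "int (g_mod n) dvd Gcd (range (fps_nth (W_ser n - 1)))"
      using g_dvd by (intro Gcd_greatest) auto
  qed auto
  thus ?thesis
    using nz g_dvd best cong_iff g_mod_eq_den_bernoulli[OF assms] by (simp add: cont_eq_Gcd)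
qed

end
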